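(* Let $k$ be a commutative ring and let $(V,\star,\alpha,1)$ be a unital hom-associative $k$-algebra. Then for all $x,y,z\in V$: \begin{align*} \alpha(x)\star(y\star z) &= (\alpha(x)\star y)\star z,\\ x\star(\alpha(y)\star z) &= (x\star\alpha(y))\star z,\\ x\star(y\star\alpha(z)) &= (x\star y)\star\alpha(z),\\ \alpha(x\star(y\star z)) &= \alpha((x\star y)\star z). \end{align*}
   Context: A hom-associative $k$-algebra $(V,\star,\alpha)$ is a $k$-module $V$ with a $k$-bilinear, not necessarily associative, product $\star: V\times V\to V$ and a $k$-linear map $\alpha:V\to V$ (the twisting map, not assumed multiplicative) such that $\alpha(x)\star(y\star z)=(x\star y)\star\alpha(z)$ for all $x,y,z\in V$. It is unital if there is an element $1\in V$ with $1\star x=x\star 1=x$ for all $x\in V$. *)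

theory Defs
  imports "HOL-Algebra.Module"
begin

definition module_linear ::
    "('k, 'm) ring_scheme \<Rightarrow> ('k, 'v, 'n) module_scheme \<Rightarrow> ('v \<Rightarrow> 'v) \<Rightarrow> bool"
  where
  "module_linear R V f \<longleftrightarrow>
     f \<in> carrier V \<rightarrow> carrier V \<and>
     (\<forall>x\<in>carrier V. \<forall>y\<in>carrier V. f (x \<oplus>\<^bsub>V\<^esub> y) = f x \<oplus>\<^bsub>V\<^esub> f y) \<and>
     (\<forall>a\<in>carrier R. \<forall>x\<in>carrier V. f (a \<odot>\<^bsub>V\<^esub> x) = a \<odot>\<^bsub>V\<^esub> f x)"

definition module_bilinear ::
    "('k, 'm) ring_scheme \<Rightarrow> ('k, 'v, 'n) module_scheme \<Rightarrow> ('v \<Rightarrow> 'v \<Rightarrow> 'v) \<Rightarrow> bool"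
  where
  "module_bilinear R V p \<longleftrightarrow>
     (\<forall>x\<in>carrier V. module_linear R V (\<lambda>y. p x y)) \<and>
     (\<forall>y\<in>carrier V. module_linear R V (\<lambda>x. p x y))"

text \<open>
  The library's module record extends the ring record, so it carries multiplication and unit
  fields which the locale \<open>module\<close> leaves unconstrained.  They serve here as the product
  and the unit of the algebra; the library's locale \<open>algebra\<close> is not usable, since it
  requires an associative and commutative product.
\<close>

locale hom_assoc_algebra = module R V
  for R (structure) and V (structure) +
  fixes \<alpha>
  assumes product_bilinear: "module_bilinear R V (\<lambda>x y. x \<otimes>\<^bsub>V\<^esub> y)"
    and twist_linear: "module_linear R V \<alpha>"
    and hom_assoc:
      "\<lbrakk>x \<in> carrier V; y \<in> carrier V; z \<in> carrier V\<rbrakk> \<Longrightarrow>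
       \<alpha> x \<otimes>\<^bsub>V\<^esub> (y \<otimes>\<^bsub>V\<^esub> z) = (x \<otimes>\<^bsub>V\<^esub> y) \<otimes>\<^bsub>V\<^esub> \<alpha> z"

locale unital_hom_assoc_algebra = hom_assoc_algebra R V \<alpha>
  for R (structure) and V (structure) and \<alpha> +
  assumes unit_closed: "\<one>\<^bsub>V\<^esub> \<in> carrier V"
    and unit_left: "x \<in> carrier V \<Longrightarrow> \<one>\<^bsub>V\<^esub> \<otimes>\<^bsub>V\<^esub> x = x"
    and unit_right: "x \<in> carrier V \<Longrightarrow> x \<otimes>\<^bsub>V\<^esub> \<one>\<^bsub>V\<^esub> = x"

end

theory Submission
  imports Defs
begin

text \<open>
  The unit forces the twisting map to commute with multiplication: substituting \<open>\<one>\<close> in one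
  slot of the hom-associativity law moves \<open>\<alpha>\<close> between the two factors of a product and out
  of the product, giving
  \<open>\<alpha> x \<otimes> y = x \<otimes> \<alpha> y = \<alpha> (x \<otimes> y)\<close> (lemmas \<open>twist_product_left\<close> and
  \<open>twist_product_right\<close>). Hence, in a product of three elements, an \<open>\<alpha>\<close> on any factor may be
  pulled outside. Hom-associativity itself then becomes
  \<open>\<alpha> (x \<otimes> (y \<otimes> z)) = \<alpha> ((x \<otimes> y) \<otimes> z)\<close>, and each of the other three identities
  reduces to this one by pulling \<open>\<alpha>\<close> out on both sides.
\<close>

context hom_assoc_algebra
begin

lemma product_closed:
  assumes "x \<in> carrier V" "y \<in> carrier V"
  shows "x \<otimes>\<^bsub>V\<^esub> y \<in> carrier V"
  using product_bilinear assms
  unfolding module_bilinear_def module_linear_def by blast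

lemma twist_closed:
  assumes "x \<in> carrier V"
  shows "\<alpha> x \<in> carrier V"
  using twist_linear assms unfolding module_linear_def by blast

end

context unital_hom_assoc_algebra
begin

text \<open>
  Hom-associativity with first entry \<open>\<one>\<close> turns \<open>x \<otimes> \<alpha> y\<close> into
  \<open>\<alpha> \<one> \<otimes> (x \<otimes> y)\<close>; with its first two entries \<open>\<one>\<close> it says that left
  multiplication by \<open>\<alpha> \<one>\<close> is \<open>\<alpha>\<close>.
\<close>

lemma twist_product_right:
  assumes x: "x \<in> carrier V" and y: "y \<in> carrier V"
  shows "x \<otimes>\<^bsub>V\<^esub> \<alpha> y = \<alpha> (x \<otimes>\<^bsub>V\<^esub> y)"
proof -
  have twist_as_mult: "\<alpha> \<one>\<^bsub>V\<^esub> \<otimes>\<^bsub>V\<^esub> z = \<alpha> z" if z: "z \<in> carrier V" for z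
    using hom_assoc[OF unit_closed unit_closed z] z
    by (simp add: unit_left unit_closed twist_closed)
  have "x \<otimes>\<^bsub>V\<^esub> \<alpha> y = \<alpha> \<one>\<^bsub>V\<^esub> \<otimes>\<^bsub>V\<^esub> (x \<otimes>\<^bsub>V\<^esub> y)"
    using hom_assoc[OF unit_closed x y] by (simp add: unit_left x)
  also have "\<dots> = \<alpha> (x \<otimes>\<^bsub>V\<^esub> y)"
    by (rule twist_as_mult[OF product_closed[OF x y]])
  finally show ?thesis .
qed

text \<open>
  With middle entry \<open>\<one>\<close>, hom-associativity moves \<open>\<alpha>\<close> from one factor to the other.
\<close>

lemma twist_product_left:
  assumes x: "x \<in> carrier V" and y: "y \<in> carrier V"
  shows "\<alpha> x \<otimes>\<^bsub>V\<^esub> y = \<alpha> (x \<otimes>\<^bsub>V\<^esub> y)"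
  using hom_assoc[OF x unit_closed y] twist_product_right[OF x y]
  by (simp add: unit_left unit_right x y)

lemma twist_assoc:
  assumes "x \<in> carrier V" "y \<in> carrier V" "z \<in> carrier V"
  shows "\<alpha> (x \<otimes>\<^bsub>V\<^esub> (y \<otimes>\<^bsub>V\<^esub> z)) = \<alpha> ((x \<otimes>\<^bsub>V\<^esub> y) \<otimes>\<^bsub>V\<^esub> z)"
  using hom_assoc[of x y z] assms
  by (simp add: twist_product_left twist_product_right product_closed)

end

theorem proposition1p1:
  fixes k :: "('k, 'm) ring_scheme"
    and V :: "('k, 'v, 'n) module_scheme"
    and \<alpha> :: "'v \<Rightarrow> 'v"
  assumes "unital_hom_assoc_algebra k V \<alpha>"
  shows "\<forall>x\<in>carrier V. \<forall>y\<in>carrier V. \<forall>z\<in>carrier V.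
      \<alpha> x \<otimes>\<^bsub>V\<^esub> (y \<otimes>\<^bsub>V\<^esub> z) = (\<alpha> x \<otimes>\<^bsub>V\<^esub> y) \<otimes>\<^bsub>V\<^esub> z \<and>
      x \<otimes>\<^bsub>V\<^esub> (\<alpha> y \<otimes>\<^bsub>V\<^esub> z) = (x \<otimes>\<^bsub>V\<^esub> \<alpha> y) \<otimes>\<^bsub>V\<^esub> z \<and>
      x \<otimes>\<^bsub>V\<^esub> (y \<otimes>\<^bsub>V\<^esub> \<alpha> z) = (x \<otimes>\<^bsub>V\<^esub> y) \<otimes>\<^bsub>V\<^esub> \<alpha> z \<and>
      \<alpha> (x \<otimes>\<^bsub>V\<^esub> (y \<otimes>\<^bsub>V\<^esub> z)) = \<alpha> ((x \<otimes>\<^bsub>V\<^esub> y) \<otimes>\<^bsub>V\<^esub> z)"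
proof -
  interpret unital_hom_assoc_algebra k V \<alpha>
    by (rule assms)
  show ?thesis
    by (simp add: twist_product_left twist_product_right product_closed twist_assoc)
qed

end
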